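(* Let $X$ be a Tychonoff space and let $I$ be an ideal in $C(X)$. Then the following statements are equivalent: (1) $C_{u^I}(X)$ is the discrete space on $C(X)$. (2) $C_{m^I}(X)$ is the discrete space on $C(X)$. (3) $C_{u^I}(X)$ is extremally disconnected. (4) $C_{m^I}(X)$ is extremally disconnected. (5) $I=\{\underline{0}\}$. (6) $C_{m^I}(X)$ is a $P$-space. (7) $C_{u^I}(X)$ is a $P$-space.
   Context: $C(X)$ is the ring of all real-valued continuous functions on $X$; ideals may be improper; $\underline 0$ is the zero function. $C_+(X)$ is the set of strictly positive $u\in C(X)$. The $u^I$-topology on $C(X)$ has as base the sets $B_u(f,I,\epsilon)=\{g\in C(X):\sup_{x\in X}|f(x)-g(x)|<\epsilon,\ f-g\in I\}$, $f\in C(X)$, $\epsilon>0$; $C_{u^I}(X)$ is $C(X)$ with this topology. The $m^I$-topology has as base the sets $B_m(f,I,u)=\{g\in C(X):|f(x)-g(x)|<u(x)\ \forall x\in X,\ f-g\in I\}$, $f\in C(X)$, $u\in C_+(X)$; $C_{m^I}(X)$ is $C(X)$ with this topology. A space is extremally disconnected if the closure of every open set is open. A $P$-space is a space in which every $G_\delta$-set is open. *)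

theory Defs
  imports "HOL-Analysis.Analysis" "HOL-Algebra.Ideal"
begin

definition tychonoff_space :: "'a topology \<Rightarrow> bool"
  where "tychonoff_space X \<longleftrightarrow> Hausdorff_space X \<and> completely_regular_space X"

definition extremally_disconnected_space :: "'a topology \<Rightarrow> bool"
  where "extremally_disconnected_space X \<longleftrightarrow> (\<forall>U. openin X U \<longrightarrow> openin X (X closure_of U))"

definition P_space :: "'a topology \<Rightarrow> bool"
  where "P_space X \<longleftrightarrow> (\<forall>S. gdelta_in X S \<longrightarrow> openin X S)"

(* Members of C(X) are extensional: they take the value undefined outside topspace X, so that
   HOL equality of members is equality of functions on X. Accordingly all pointwise operations
   below are restricted to topspace X. *)
definition cfun :: "'a topology \<Rightarrow> ('a \<Rightarrow> real) set"
  where "cfun X = {f \<in> extensional (topspace X). continuous_map X euclideanreal f}"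

definition cfun_pos :: "'a topology \<Rightarrow> ('a \<Rightarrow> real) set"
  where "cfun_pos X = {u \<in> cfun X. \<forall>x\<in>topspace X. 0 < u x}"

definition cfun_ring :: "'a topology \<Rightarrow> ('a \<Rightarrow> real) ring"
  where "cfun_ring X =
    \<lparr>carrier = cfun X,
     monoid.mult = (\<lambda>f g. \<lambda>x\<in>topspace X. f x * g x),
     one = (\<lambda>x\<in>topspace X. 1),
     zero = (\<lambda>x\<in>topspace X. 0),
     add = (\<lambda>f g. \<lambda>x\<in>topspace X. f x + g x)\<rparr>"

definition cfun_diff :: "'a topology \<Rightarrow> ('a \<Rightarrow> real) \<Rightarrow> ('a \<Rightarrow> real) \<Rightarrow> ('a \<Rightarrow> real)"
  where "cfun_diff X f g = (\<lambda>x\<in>topspace X. f x - g x)"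

(* The supremum is taken in the extended reals, so it is infinity when f - g is unbounded. *)
definition B_u :: "'a topology \<Rightarrow> ('a \<Rightarrow> real) \<Rightarrow> ('a \<Rightarrow> real) set \<Rightarrow> real \<Rightarrow> ('a \<Rightarrow> real) set"
  where "B_u X f I \<epsilon> =
    {g \<in> cfun X. (SUP x\<in>topspace X. ereal \<bar>f x - g x\<bar>) < ereal \<epsilon> \<and> cfun_diff X f g \<in> I}"

definition B_m :: "'a topology \<Rightarrow> ('a \<Rightarrow> real) \<Rightarrow> ('a \<Rightarrow> real) set \<Rightarrow> ('a \<Rightarrow> real) \<Rightarrow> ('a \<Rightarrow> real) set"
  where "B_m X f I u =
    {g \<in> cfun X. (\<forall>x\<in>topspace X. \<bar>f x - g x\<bar> < u x) \<and> cfun_diff X f g \<in> I}"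

definition u_base :: "'a topology \<Rightarrow> ('a \<Rightarrow> real) set \<Rightarrow> ('a \<Rightarrow> real) set set"
  where "u_base X I = {B_u X f I \<epsilon> | f \<epsilon>. f \<in> cfun X \<and> 0 < \<epsilon>}"

definition m_base :: "'a topology \<Rightarrow> ('a \<Rightarrow> real) set \<Rightarrow> ('a \<Rightarrow> real) set set"
  where "m_base X I = {B_m X f I u | f u. f \<in> cfun X \<and> u \<in> cfun_pos X}"

(* The open sets are the unions of basic sets; see openin_C_u and openin_C_m below. *)
definition C_u :: "'a topology \<Rightarrow> ('a \<Rightarrow> real) set \<Rightarrow> ('a \<Rightarrow> real) topology"
  where "C_u X I = topology (arbitrary union_of (\<lambda>B. B \<in> u_base X I))"

definition C_m :: "'a topology \<Rightarrow> ('a \<Rightarrow> real) set \<Rightarrow> ('a \<Rightarrow> real) topology"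
  where "C_m X I = topology (arbitrary union_of (\<lambda>B. B \<in> m_base X I))"

lemma cfun_ring_sel [simp]:
  "carrier (cfun_ring X) = cfun X"
  "f \<otimes>\<^bsub>cfun_ring X\<^esub> g = (\<lambda>x\<in>topspace X. f x * g x)"
  "\<one>\<^bsub>cfun_ring X\<^esub> = (\<lambda>x\<in>topspace X. 1)"
  "\<zero>\<^bsub>cfun_ring X\<^esub> = (\<lambda>x\<in>topspace X. 0)"
  "f \<oplus>\<^bsub>cfun_ring X\<^esub> g = (\<lambda>x\<in>topspace X. f x + g x)"
  by (simp_all add: cfun_ring_def)

lemma cfun_restrictI:
  assumes "continuous_map X euclideanreal f"
  shows "restrict f (topspace X) \<in> cfun X"
proof -
  have "continuous_map X euclideanreal (restrict f (topspace X))"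
    by (rule continuous_map_eq [OF assms]) simp
  then show ?thesis
    by (simp add: cfun_def)
qed

lemma cfun_continuous: "f \<in> cfun X \<Longrightarrow> continuous_map X euclideanreal f"
  by (simp add: cfun_def)

lemma cfun_diff_closed: "\<lbrakk>f \<in> cfun X; g \<in> cfun X\<rbrakk> \<Longrightarrow> cfun_diff X f g \<in> cfun X"
  unfolding cfun_diff_def
  by (intro cfun_restrictI continuous_map_diff cfun_continuous)

lemma cring_cfun_ring: "cring (cfun_ring X)"
proof (rule cringI)
  show "abelian_group (cfun_ring X)"
  proof (rule abelian_groupI; simp)
    fix f g assume "f \<in> cfun X" "g \<in> cfun X"
    then show "(\<lambda>x\<in>topspace X. f x + g x) \<in> cfun X"
      by (intro cfun_restrictI continuous_map_add cfun_continuous)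
  next
    show "(\<lambda>x\<in>topspace X. 0) \<in> cfun X"
      by (intro cfun_restrictI) simp
  next
    fix f assume f: "f \<in> cfun X"
    then show "(\<lambda>x\<in>topspace X. (if x \<in> topspace X then 0 else undefined) + f x) = f"
      by (intro ext) (auto simp: cfun_def extensional_def)
    have "(\<lambda>x\<in>topspace X. - f x) \<in> cfun X"
      using f by (intro cfun_restrictI continuous_map_minus cfun_continuous)
    then show "\<exists>h\<in>cfun X. (\<lambda>x\<in>topspace X. h x + f x) = (\<lambda>x\<in>topspace X. 0)"
      by (rule rev_bexI) (rule restrict_ext; simp)
  qed (auto intro!: restrict_ext simp: algebra_simps)
next
  show "comm_monoid (cfun_ring X)"
  proof (rule comm_monoidI; simp)
    fix f g assume "f \<in> cfun X" "g \<in> cfun X"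
    then show "(\<lambda>x\<in>topspace X. f x * g x) \<in> cfun X"
      by (intro cfun_restrictI continuous_map_real_mult cfun_continuous)
  next
    show "(\<lambda>x\<in>topspace X. 1) \<in> cfun X"
      by (intro cfun_restrictI) simp
  next
    fix f assume f: "f \<in> cfun X"
    then show "(\<lambda>x\<in>topspace X. (if x \<in> topspace X then 1 else undefined) * f x) = f"
      by (intro ext) (auto simp: cfun_def extensional_def)
  qed (auto intro!: restrict_ext simp: algebra_simps)
qed (auto intro!: restrict_ext simp: algebra_simps)

lemma SUP_ereal_less_iff:
  "(SUP x\<in>A. ereal (h x)) < ereal e \<longleftrightarrow> (\<exists>d<e. \<forall>x\<in>A. h x \<le> d)"
proof
  assume "(SUP x\<in>A. ereal (h x)) < ereal e"
  then obtain d where d: "(SUP x\<in>A. ereal (h x)) < ereal d" "ereal d < ereal e"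
    using ereal_dense2 by blast
  have "h x \<le> d" if "x \<in> A" for x
    using SUP_upper [OF that, of "\<lambda>x. ereal (h x)"] d(1)
    by (metis ereal_less_eq(3) le_less_trans less_imp_le)
  with d(2) show "\<exists>d<e. \<forall>x\<in>A. h x \<le> d"
    by auto
next
  assume "\<exists>d<e. \<forall>x\<in>A. h x \<le> d"
  then obtain d where d: "d < e" "\<forall>x\<in>A. h x \<le> d"
    by blast
  have "(SUP x\<in>A. ereal (h x)) \<le> ereal d"
    using d(2) by (intro SUP_least) simp
  with d(1) show "(SUP x\<in>A. ereal (h x)) < ereal e"
    by (simp add: le_less_trans)
qed

lemma cfun_diff_trans:
  assumes "ideal I (cfun_ring X)" "cfun_diff X f g \<in> I" "cfun_diff X g h \<in> I"
  shows "cfun_diff X f h \<in> I"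
proof -
  interpret ideal I "cfun_ring X" by fact
  have "cfun_diff X f g \<oplus>\<^bsub>cfun_ring X\<^esub> cfun_diff X g h \<in> I"
    using is_additive_subgroup assms(2,3) by (rule additive_subgroup.a_closed)
  moreover have "cfun_diff X f g \<oplus>\<^bsub>cfun_ring X\<^esub> cfun_diff X g h = cfun_diff X f h"
    by (auto simp: cfun_diff_def intro!: restrict_ext)
  ultimately show ?thesis by simp
qed

lemma cfun_diff_self:
  assumes "ideal I (cfun_ring X)"
  shows "cfun_diff X f f \<in> I"
proof -
  interpret ideal I "cfun_ring X" by fact
  show ?thesis
    using additive_subgroup.zero_closed [OF is_additive_subgroup] by (simp add: cfun_diff_def)
qed

lemma B_u_self: "\<lbrakk>ideal I (cfun_ring X); f \<in> cfun X; 0 < \<epsilon>\<rbrakk> \<Longrightarrow> f \<in> B_u X f I \<epsilon>"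
  by (auto simp: B_u_def cfun_diff_self SUP_ereal_less_iff)

lemma B_m_self: "\<lbrakk>ideal I (cfun_ring X); f \<in> cfun X; u \<in> cfun_pos X\<rbrakk> \<Longrightarrow> f \<in> B_m X f I u"
  by (auto simp: B_m_def cfun_diff_self cfun_pos_def)

lemma u_baseI: "\<lbrakk>f \<in> cfun X; 0 < \<epsilon>\<rbrakk> \<Longrightarrow> B_u X f I \<epsilon> \<in> u_base X I"
  unfolding u_base_def by blast

lemma m_baseI: "\<lbrakk>f \<in> cfun X; u \<in> cfun_pos X\<rbrakk> \<Longrightarrow> B_m X f I u \<in> m_base X I"
  unfolding m_base_def by blast

lemma B_u_refine:
  assumes I: "ideal I (cfun_ring X)" and g: "g \<in> B_u X f I \<epsilon>"
  obtains \<delta> where "0 < \<delta>" "\<And>\<delta>'. \<delta>' \<le> \<delta> \<Longrightarrow> B_u X g I \<delta>' \<subseteq> B_u X f I \<epsilon>"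
proof -
  from g obtain d where d: "d < \<epsilon>" "\<forall>x\<in>topspace X. \<bar>f x - g x\<bar> \<le> d"
    and fg: "cfun_diff X f g \<in> I"
    by (auto simp: B_u_def SUP_ereal_less_iff)
  show thesis
  proof
    show "0 < \<epsilon> - d" using d by simp
    fix \<delta>' assume \<delta>': "\<delta>' \<le> \<epsilon> - d"
    show "B_u X g I \<delta>' \<subseteq> B_u X f I \<epsilon>"
    proof
      fix h assume h: "h \<in> B_u X g I \<delta>'"
      then obtain e where e: "e < \<delta>'" "\<forall>x\<in>topspace X. \<bar>g x - h x\<bar> \<le> e"
        by (auto simp: B_u_def SUP_ereal_less_iff)
      have "\<forall>x\<in>topspace X. \<bar>f x - h x\<bar> \<le> d + e"
        using d(2) e(2) by (smt (verit))
      moreover have "d + e < \<epsilon>" using \<delta>' e(1) by simp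
      ultimately show "h \<in> B_u X f I \<epsilon>"
        using h cfun_diff_trans [OF I fg] by (auto simp: B_u_def SUP_ereal_less_iff)
    qed
  qed
qed

lemma openin_C_u:
  assumes I: "ideal I (cfun_ring X)"
  shows "openin (C_u X I) = arbitrary union_of (\<lambda>B. B \<in> u_base X I)"
proof -
  have "istopology (arbitrary union_of (\<lambda>B. B \<in> u_base X I))"
    unfolding istopology_base_eq arbitrary_union_of_alt
  proof (intro allI impI ballI)
    fix S T g assume ST: "S \<in> u_base X I \<and> T \<in> u_base X I" and g: "g \<in> S \<inter> T"
    then obtain f1 e1 f2 e2 where S: "S = B_u X f1 I e1" and T: "T = B_u X f2 I e2"
      by (auto simp: u_base_def)
    obtain d1 where d1: "0 < d1" "\<And>d. d \<le> d1 \<Longrightarrow> B_u X g I d \<subseteq> S"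
      using B_u_refine [OF I, of g f1 e1] g S by blast
    obtain d2 where d2: "0 < d2" "\<And>d. d \<le> d2 \<Longrightarrow> B_u X g I d \<subseteq> T"
      using B_u_refine [OF I, of g f2 e2] g T by blast
    have gC: "g \<in> cfun X"
      using g S by (simp add: B_u_def)
    show "\<exists>U. U \<in> u_base X I \<and> g \<in> U \<and> U \<subseteq> S \<inter> T"
    proof (intro exI conjI)
      show "B_u X g I (min d1 d2) \<in> u_base X I"
        using gC d1(1) d2(1) by (intro u_baseI) simp_all
      show "g \<in> B_u X g I (min d1 d2)"
        using B_u_self [OF I gC] d1(1) d2(1) by simp
      show "B_u X g I (min d1 d2) \<subseteq> S \<inter> T"
        using d1(2) d2(2) by simp
    qed
  qed
  then show ?thesis
    by (simp add: C_u_def topology_inverse')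
qed

lemma openin_C_m:
  assumes I: "ideal I (cfun_ring X)"
  shows "openin (C_m X I) = arbitrary union_of (\<lambda>B. B \<in> m_base X I)"
proof -
  have "istopology (arbitrary union_of (\<lambda>B. B \<in> m_base X I))"
    unfolding istopology_base_eq arbitrary_union_of_alt
  proof (intro allI impI ballI)
    fix S T g assume ST: "S \<in> m_base X I \<and> T \<in> m_base X I" and g: "g \<in> S \<inter> T"
    then obtain f1 u1 f2 u2 where S: "S = B_m X f1 I u1" and T: "T = B_m X f2 I u2"
      and C: "f1 \<in> cfun X" "f2 \<in> cfun X" "u1 \<in> cfun X" "u2 \<in> cfun X"
      by (auto simp: m_base_def cfun_pos_def)
    have gC: "g \<in> cfun X"
      using g S by (simp add: B_m_def)
    define u where "u = (\<lambda>x\<in>topspace X. min (u1 x - \<bar>f1 x - g x\<bar>) (u2 x - \<bar>f2 x - g x\<bar>))"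
    have "u \<in> cfun X"
      unfolding u_def using C gC
      by (intro cfun_restrictI continuous_map_real_min continuous_map_diff
            continuous_map_real_abs cfun_continuous)
    moreover have "\<forall>x\<in>topspace X. 0 < u x"
      using g by (auto simp: S T B_m_def u_def)
    ultimately have u: "u \<in> cfun_pos X"
      by (simp add: cfun_pos_def)
    show "\<exists>U. U \<in> m_base X I \<and> g \<in> U \<and> U \<subseteq> S \<inter> T"
    proof (intro exI conjI)
      show "B_m X g I u \<in> m_base X I"
        using gC u by (rule m_baseI)
      show "g \<in> B_m X g I u"
        by (rule B_m_self [OF I gC u])
      show "B_m X g I u \<subseteq> S \<inter> T"
      proof
        fix h assume h: "h \<in> B_m X g I u"
        have gh: "\<bar>g x - h x\<bar> < u1 x - \<bar>f1 x - g x\<bar> \<and> \<bar>g x - h x\<bar> < u2 x - \<bar>f2 x - g x\<bar>"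
          if "x \<in> topspace X" for x
          using h that by (auto simp: B_m_def u_def)
        have "\<bar>f1 x - h x\<bar> < u1 x \<and> \<bar>f2 x - h x\<bar> < u2 x" if "x \<in> topspace X" for x
          using gh [OF that] by linarith
        moreover have "cfun_diff X f1 h \<in> I" "cfun_diff X f2 h \<in> I"
          using g h cfun_diff_trans [OF I] by (auto simp: S T B_m_def)
        ultimately show "h \<in> S \<inter> T"
          using h by (auto simp: S T B_m_def)
      qed
    qed
  qed
  then show ?thesis
    by (simp add: C_m_def topology_inverse')
qed

lemma topspace_C_u:
  assumes "ideal I (cfun_ring X)"
  shows "topspace (C_u X I) = cfun X"
proof
  show "topspace (C_u X I) \<subseteq> cfun X"
    using openin_topspace [of "C_u X I"]
    unfolding openin_C_u [OF assms] by (auto simp: union_of_def u_base_def B_u_def)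
  have "openin (C_u X I) (B_u X f I 1)" if "f \<in> cfun X" for f
    unfolding openin_C_u [OF assms] using that
    by (intro arbitrary_union_of_inc u_baseI) simp_all
  then show "cfun X \<subseteq> topspace (C_u X I)"
    using B_u_self [OF assms] openin_subset by (metis subsetD subsetI zero_less_one)
qed

lemma topspace_C_m:
  assumes "ideal I (cfun_ring X)"
  shows "topspace (C_m X I) = cfun X"
proof
  show "topspace (C_m X I) \<subseteq> cfun X"
    using openin_topspace [of "C_m X I"]
    unfolding openin_C_m [OF assms] by (auto simp: union_of_def m_base_def B_m_def)
  have one: "(\<lambda>x\<in>topspace X. 1) \<in> cfun_pos X"
    using cfun_restrictI [of X "\<lambda>x. 1"] by (simp add: cfun_pos_def)
  have "openin (C_m X I) (B_m X f I (\<lambda>x\<in>topspace X. 1))" if "f \<in> cfun X" for f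
    unfolding openin_C_m [OF assms] using that one
    by (intro arbitrary_union_of_inc m_baseI)
  then show "cfun X \<subseteq> topspace (C_m X I)"
    using B_m_self [OF assms _ one] openin_subset by (metis subsetD subsetI)
qed

end

theory Submission
  imports Defs
begin

text \<open>
  If \<open>f \<in> I\<close> does not vanish at \<open>x\<close>, then every neighbourhood of \<open>0\<close>, in either topology, contains
  multiples of \<open>f\<close> that are positive at \<open>x\<close> and multiples that are negative at \<open>x\<close>. Hence \<open>0\<close> is a
  boundary point of the closure of the open set \<open>{g. g x > 0}\<close>, and the \<open>G\<^sub>\<delta>\<close>-set \<open>{0}\<close> is not
  open. All of this applies to any topology lying between \<open>C_u X I\<close> and \<open>C_m X I\<close>.
\<close>

section \<open>Discrete topologies, and passage to a finer topology\<close>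

lemma extremally_disconnected_space_discrete_topology:
  "extremally_disconnected_space (discrete_topology S)"
  by (simp add: extremally_disconnected_space_def discrete_topology_closure_of)

lemma P_space_discrete_topology: "P_space (discrete_topology S)"
  using gdelta_in_subset by (fastforce simp: P_space_def)

text \<open>Carries the \<open>gdelta_in\<close> property of the zero singleton from
  \<open>C_u X I\<close> to the topologies above it. The topspaces have to agree because
  \<open>gdelta_in\<close> also demands containment in the topspace.\<close>

lemma gdelta_in_mono:
  assumes "topspace T = topspace S" "\<And>U. openin S U \<Longrightarrow> openin T U" "gdelta_in S A"
  shows "gdelta_in T A"
proof -
  obtain \<U> where "countable \<U>" "\<U> \<subseteq> Collect (openin S)" "\<Inter>\<U> = A"
    using assms(3) unfolding gdelta_in_alt intersection_of_def by metis
  moreover from this(2) have "\<U> \<subseteq> Collect (openin T)"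
    using assms(2) by blast
  ultimately have "(countable intersection_of openin T) A"
    unfolding intersection_of_def by metis
  then show ?thesis
    using assms(1,3) by (simp add: gdelta_in_alt)
qed

section \<open>Open sets of the two topologies\<close>

context
  fixes X :: "'a topology" and I :: "('a \<Rightarrow> real) set"
  assumes I: "ideal I (cfun_ring X)"
begin

lemma openin_B_u: "\<lbrakk>f \<in> cfun X; 0 < \<epsilon>\<rbrakk> \<Longrightarrow> openin (C_u X I) (B_u X f I \<epsilon>)"
  unfolding openin_C_u [OF I] by (intro arbitrary_union_of_inc u_baseI)

text \<open>By the triangle inequality a basic set contains a basic set centred at any of its
  points, so openness can be tested with centred balls, as in a metric space.\<close>

lemma openin_C_u_iff:
  "openin (C_u X I) S \<longleftrightarrow> S \<subseteq> cfun X \<and> (\<forall>f\<in>S. \<exists>\<epsilon>>0. B_u X f I \<epsilon> \<subseteq> S)"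
proof safe
  assume S: "openin (C_u X I) S"
  then show "f \<in> cfun X" if "f \<in> S" for f
    using that openin_subset topspace_C_u [OF I] by blast
  fix f assume "f \<in> S"
  then obtain B where "B \<in> u_base X I" "f \<in> B" "B \<subseteq> S"
    using S unfolding openin_C_u [OF I] arbitrary_union_of_alt by blast
  then show "\<exists>\<epsilon>>0. B_u X f I \<epsilon> \<subseteq> S"
    using B_u_refine [OF I] unfolding u_base_def by (smt (verit) mem_Collect_eq order_refl subset_trans)
next
  assume "S \<subseteq> cfun X" "\<forall>f\<in>S. \<exists>\<epsilon>>0. B_u X f I \<epsilon> \<subseteq> S"
  then show "openin (C_u X I) S"
    by (subst openin_subopen) (metis B_u_self I openin_B_u subsetD)
qed

lemma openin_C_m_nhd:
  assumes S: "openin (C_m X I) S" and f: "f \<in> S"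
  obtains u where "u \<in> cfun_pos X" "B_m X f I u \<subseteq> S"
proof -
  obtain h v where h: "h \<in> cfun X" and v: "v \<in> cfun_pos X"
    and fB: "f \<in> B_m X h I v" and BS: "B_m X h I v \<subseteq> S"
    using S f unfolding openin_C_m [OF I] arbitrary_union_of_alt m_base_def by blast
  \<comment> \<open>The slack left at \<open>f\<close> inside the set around \<open>h\<close>:
    positive because \<open>f\<close> lies in that set, and small enough for the triangle
    inequality.\<close>
  define u where "u = (\<lambda>x\<in>topspace X. v x - \<bar>h x - f x\<bar>)"
  have "u \<in> cfun X"
    unfolding u_def using h v fB
    by (intro cfun_restrictI continuous_map_diff continuous_map_real_abs cfun_continuous)
      (auto simp: cfun_pos_def B_m_def)
  then have "u \<in> cfun_pos X"
    using fB by (auto simp: cfun_pos_def u_def B_m_def)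
  moreover have "B_m X f I u \<subseteq> B_m X h I v"
  proof
    fix g assume g: "g \<in> B_m X f I u"
    then have "\<bar>h x - g x\<bar> < v x" if "x \<in> topspace X" for x
      using that by (force simp: B_m_def u_def)
    then show "g \<in> B_m X h I v"
      using g fB cfun_diff_trans [OF I] by (auto simp: B_m_def)
  qed
  ultimately show thesis
    using BS that by blast
qed

text \<open>Positive constants are among the functions allowed as radii in the m-topology.\<close>

lemma openin_C_u_imp_C_m:
  assumes "openin (C_u X I) S"
  shows "openin (C_m X I) S"
proof (subst openin_subopen, intro ballI)
  fix f assume "f \<in> S"
  then obtain \<epsilon> where f: "f \<in> cfun X" and \<epsilon>: "\<epsilon> > 0" "B_u X f I \<epsilon> \<subseteq> S"
    using assms openin_C_u_iff by blast
  \<comment> \<open>Halving is needed since a pointwise bound \<open>< \<epsilon>\<close> only gives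
    a supremum \<open>\<le> \<epsilon>\<close>, whereas \<open>B_u\<close> asks for a strict
    one.\<close>
  define u where "u = (\<lambda>x\<in>topspace X. \<epsilon> / 2)"
  have u: "u \<in> cfun_pos X"
    using \<epsilon> cfun_restrictI [of X "\<lambda>x. \<epsilon> / 2"] by (simp add: cfun_pos_def u_def)
  have "\<exists>d<\<epsilon>. \<forall>x\<in>topspace X. \<bar>f x - g x\<bar> \<le> d" if "g \<in> B_m X f I u" for g
    using that \<epsilon>(1) by (intro exI [of _ "\<epsilon> / 2"]) (auto simp: B_m_def u_def less_imp_le)
  then have "B_m X f I u \<subseteq> B_u X f I \<epsilon>"
    by (auto simp: B_u_def SUP_ereal_less_iff) (auto simp: B_m_def)
  moreover have "openin (C_m X I) (B_m X f I u)"
    unfolding openin_C_m [OF I] using f u by (intro arbitrary_union_of_inc m_baseI)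
  ultimately show "\<exists>T. openin (C_m X I) T \<and> f \<in> T \<and> T \<subseteq> S"
    using B_m_self [OF I f u] \<epsilon>(2) by blast
qed

text \<open>Evaluation at \<open>x\<close> is continuous, since the uniform distance dominates the
  distance of the values at \<open>x\<close>.\<close>

lemma openin_C_u_evaluation:
  assumes x: "x \<in> topspace X" and "open A"
  shows "openin (C_u X I) {f \<in> cfun X. f x \<in> A}"
  unfolding openin_C_u_iff
proof safe
  fix f assume "f x \<in> A"
  then obtain \<epsilon> where \<epsilon>: "\<epsilon> > 0" "\<And>y. \<bar>f x - y\<bar> < \<epsilon> \<Longrightarrow> y \<in> A"
    using \<open>open A\<close> by (metis open_dist dist_real_def abs_minus_commute)
  have "B_u X f I \<epsilon> \<subseteq> {f \<in> cfun X. f x \<in> A}"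
    using \<epsilon>(2) x by (force simp: B_u_def SUP_ereal_less_iff)
  with \<epsilon>(1) show "\<exists>\<epsilon>>0. B_u X f I \<epsilon> \<subseteq> {f \<in> cfun X. f x \<in> A}"
    by blast
qed

section \<open>The zero function and its neighbourhoods\<close>

lemma zero_in_cfun: "\<zero>\<^bsub>cfun_ring X\<^esub> \<in> cfun X"
  using cfun_restrictI [of X "\<lambda>x. 0"] by simp

lemma gdelta_in_C_u_zero: "gdelta_in (C_u X I) {\<zero>\<^bsub>cfun_ring X\<^esub>}"
proof -
  let ?z = "\<zero>\<^bsub>cfun_ring X\<^esub>"
  \<comment> \<open>Countably many balls with radii tending to 0; by the Archimedean property only
    zero lies in all of them. \<open>Suc\<close> keeps every radius positive.\<close>
  let ?B = "\<lambda>n. B_u X ?z I (inverse (real (Suc n)))"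
  have "f = ?z" if f: "\<And>n. f \<in> ?B n" for f
  proof (rule extensionalityI)
    show "f \<in> extensional (topspace X)" "?z \<in> extensional (topspace X)"
      using f [of 0] by (simp_all add: cfun_def B_u_def)
    fix x assume x: "x \<in> topspace X"
    have "\<bar>f x\<bar> < inverse (real (Suc n))" for n
      using f [of n] x by (force simp: B_u_def SUP_ereal_less_iff)
    then show "f x = ?z x"
      using x reals_Archimedean [of "\<bar>f x\<bar>"] by (force dest: less_asym)
  qed
  then have "(\<Inter>n. ?B n) \<subseteq> {?z}"
    by blast
  moreover have "?z \<in> ?B n" for n
    by (intro B_u_self I zero_in_cfun) simp
  ultimately have "{?z} = (\<Inter>n. ?B n)"
    by (intro equalityI INT_greatest) simp_all
  moreover have "gdelta_in (C_u X I) \<dots>"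
  proof (rule gdelta_in_Inter)
    fix S assume "S \<in> range ?B"
    then obtain n where "S = ?B n" ..
    then show "gdelta_in (C_u X I) S"
      using openin_B_u [OF zero_in_cfun] by (metis inverse_positive_iff_positive of_nat_0_less_iff open_imp_gdelta_in zero_less_Suc)
  qed simp_all
  ultimately show ?thesis by simp
qed

text \<open>Only the sign of \<open>s\<close> matters: 1 and -1 give members of \<open>S\<close>
  that are positive and negative at \<open>x\<close>. The witness is a multiple of \<open>f\<close>
  damped to stay below the given radius \<open>u\<close>.\<close>

lemma C_m_nhd_zero_sign:
  assumes S: "openin (C_m X I) S" "\<zero>\<^bsub>cfun_ring X\<^esub> \<in> S"
    and f: "f \<in> I" and x: "x \<in> topspace X" "f x \<noteq> 0" and "s \<noteq> 0"
  shows "\<exists>g\<in>S. 0 < s * g x"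
proof -
  interpret ideal I "cfun_ring X" by (rule I)
  obtain u where u: "u \<in> cfun_pos X" and uS: "B_m X \<zero>\<^bsub>cfun_ring X\<^esub> I u \<subseteq> S"
    using openin_C_m_nhd [OF S] .
  have fC: "f \<in> cfun X" using f a_subset by auto
  define c where "c = sgn (s * f x)"
  \<comment> \<open>The product \<open>f * k c\<close> has absolute value
    \<open>u * \<bar>f\<bar> / (1 + \<bar>f\<bar>) < u\<close>, and the denominator never vanishes,
    so \<open>k a\<close> is continuous. The sign \<open>c\<close> makes \<open>s * g x\<close>
    positive.\<close>
  define k where "k a = (\<lambda>y\<in>topspace X. a * (u y / (1 + \<bar>f y\<bar>)))" for a :: real
  have k: "k a \<in> cfun X" for a
    unfolding k_def using fC u
    by (intro cfun_restrictI continuous_map_real_mult continuous_map_real_divide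
        continuous_map_add continuous_map_real_abs)
      (auto simp: cfun_pos_def intro: cfun_continuous)
  define g where "g = (\<lambda>y\<in>topspace X. f y * k c y)"
  have g: "g \<in> cfun X"
    unfolding g_def using fC k by (intro cfun_restrictI continuous_map_real_mult cfun_continuous)
  \<comment> \<open>\<open>B_m\<close> tests zero minus \<open>g\<close>, hence the factor with
    \<open>- c\<close>.\<close>
  have "cfun_diff X \<zero>\<^bsub>cfun_ring X\<^esub> g = f \<otimes>\<^bsub>cfun_ring X\<^esub> k (- c)"
    by (auto simp: cfun_diff_def g_def k_def intro!: restrict_ext)
  also have "\<dots> \<in> I"
    using I_r_closed [OF f] k by (simp del: cfun_ring_sel(2-))
  finally have "cfun_diff X \<zero>\<^bsub>cfun_ring X\<^esub> g \<in> I" .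
  moreover have "\<bar>g y\<bar> < u y" if "y \<in> topspace X" for y
  proof -
    have uy: "0 < u y" using u that by (simp add: cfun_pos_def)
    have "\<bar>g y\<bar> = \<bar>c\<bar> * (u y * (\<bar>f y\<bar> / (1 + \<bar>f y\<bar>)))"
      using that uy by (simp add: g_def k_def abs_mult)
    also have "\<dots> = u y * (\<bar>f y\<bar> / (1 + \<bar>f y\<bar>))"
      using x(2) \<open>s \<noteq> 0\<close> by (simp add: c_def abs_sgn_eq)
    also have "\<dots> < u y * 1"
      using uy by (intro mult_strict_left_mono) auto
    finally show ?thesis by simp
  qed
  ultimately have "g \<in> S"
    using uS g by (auto simp: B_m_def)
  moreover have "s * g x = \<bar>s * f x\<bar> * (u x / (1 + \<bar>f x\<bar>))"
    using x(1) by (simp add: g_def k_def c_def abs_sgn [of "s * f x"])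
  then have "0 < s * g x"
    using x u \<open>s \<noteq> 0\<close> by (simp add: cfun_pos_def add_pos_nonneg)
  ultimately show ?thesis by blast
qed

section \<open>The equivalences for an intermediate topology\<close>

lemma nonzero_in_ideal:
  assumes "I \<noteq> {\<zero>\<^bsub>cfun_ring X\<^esub>}"
  obtains f x where "f \<in> I" "x \<in> topspace X" "f x \<noteq> 0"
proof -
  interpret ideal I "cfun_ring X" by (rule I)
  have "\<zero>\<^bsub>cfun_ring X\<^esub> \<in> I"
    using additive_subgroup.zero_closed [OF is_additive_subgroup] .
  then obtain f where f: "f \<in> I" "f \<noteq> \<zero>\<^bsub>cfun_ring X\<^esub>"
    using assms by blast
  \<comment> \<open>Both functions are \<open>undefined\<close> off \<open>topspace X\<close>, so
    they must differ at a point of it.\<close>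
  moreover have "f \<in> extensional (topspace X)"
    using f(1) a_subset by (auto simp: cfun_def)
  ultimately show thesis
    using that by (force intro: extensionalityI)
qed

text \<open>One argument serves both topologies: the sets that must be open or
  \<open>G\<^sub>\<delta>\<close> are already so in \<open>C_u X I\<close>, and neighbourhoods of
  zero are examined in \<open>C_m X I\<close>.\<close>

lemma
  assumes uT: "\<And>S. openin (C_u X I) S \<Longrightarrow> openin T S"
    and Tm: "\<And>S. openin T S \<Longrightarrow> openin (C_m X I) S"
  shows discrete_iff_zero_ideal: "T = discrete_topology (cfun X) \<longleftrightarrow> I = {\<zero>\<^bsub>cfun_ring X\<^esub>}"
    and extremally_disconnected_iff_zero_ideal:
      "extremally_disconnected_space T \<longleftrightarrow> I = {\<zero>\<^bsub>cfun_ring X\<^esub>}"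
    and P_space_iff_zero_ideal: "P_space T \<longleftrightarrow> I = {\<zero>\<^bsub>cfun_ring X\<^esub>}"
proof -
  let ?z = "\<zero>\<^bsub>cfun_ring X\<^esub>"
  have topT: "topspace T = cfun X"
    using uT Tm topspace_C_u [OF I] topspace_C_m [OF I]
    by (metis openin_subset openin_topspace subset_antisym)
  have discrete: "T = discrete_topology (cfun X)" if "I = {?z}"
  proof -
    have "openin T {f}" if f: "f \<in> cfun X" for f
    proof -
      \<comment> \<open>The ideal condition alone forces \<open>g = f\<close>; the radius 1 is
        arbitrary.\<close>
      have "g = f" if "g \<in> B_u X f I 1" for g
      proof (rule extensionalityI)
        show "g \<in> extensional (topspace X)" "f \<in> extensional (topspace X)"
          using that f by (auto simp: B_u_def cfun_def)
        have "cfun_diff X f g = ?z"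
          using that \<open>I = {?z}\<close> by (auto simp: B_u_def)
        then show "g x = f x" if "x \<in> topspace X" for x
          using that by (auto simp: cfun_diff_def dest: fun_cong [where x = x])
      qed
      then have "B_u X f I 1 = {f}"
        using B_u_self [OF I f, of 1] by auto
      then show ?thesis
        using uT openin_B_u [OF f, of 1] by simp
    qed
    then show ?thesis
      by (metis discrete_topology_unique topT)
  qed
  have P: "I = {?z}" if "P_space T"
  proof (rule ccontr)
    assume "I \<noteq> {?z}"
    then obtain f x where fx: "f \<in> I" "x \<in> topspace X" "f x \<noteq> 0"
      by (rule nonzero_in_ideal)
    have "gdelta_in T {?z}"
      using gdelta_in_mono [OF _ uT gdelta_in_C_u_zero] topT topspace_C_u [OF I] by simp
    then have "openin (C_m X I) {?z}"
      using that Tm by (simp add: P_space_def)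
    from C_m_nhd_zero_sign [OF this _ fx, of 1] fx(2) show False
      by simp
  qed
  have E: "I = {?z}" if "extremally_disconnected_space T"
  proof (rule ccontr)
    assume "I \<noteq> {?z}"
    then obtain f x where fx: "f \<in> I" "x \<in> topspace X" "f x \<noteq> 0"
      by (rule nonzero_in_ideal)
    let ?U = "{g \<in> cfun X. g x \<in> {0<..}}"
    let ?V = "{g \<in> cfun X. g x \<in> {..<0}}"
    have U: "openin T ?U" and V: "openin T ?V"
      using fx(2) by (intro uT openin_C_u_evaluation; simp)+
    \<comment> \<open>Zero is a limit of multiples of \<open>f\<close> that are positive at
      \<open>x\<close>.\<close>
    have "?z \<in> T closure_of ?U"
      unfolding in_closure_of topT
    proof (intro conjI allI impI zero_in_cfun)
      fix S assume S: "?z \<in> S \<and> openin T S"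
      have "\<exists>g\<in>S. 0 < 1 * g x"
        by (rule C_m_nhd_zero_sign [OF Tm _ fx]) (use S in simp_all)
      then show "\<exists>g. g \<in> ?U \<and> g \<in> S"
        using S openin_subset [of T S] topT by auto
    qed
    \<comment> \<open>The closure is now a neighbourhood of zero, so it also contains a function
      negative at \<open>x\<close>. That function lies in the open set \<open>?V\<close>, which is
      disjoint from \<open>?U\<close> and hence from its closure.\<close>
    moreover have "openin (C_m X I) (T closure_of ?U)"
      using that U Tm by (simp only: extremally_disconnected_space_def)
    ultimately have "\<exists>g\<in>T closure_of ?U. 0 < (- 1) * g x"
      by (intro C_m_nhd_zero_sign [OF _ _ fx]) simp_all
    then obtain g where g: "g \<in> T closure_of ?U" "g x < 0"
      by auto
    then have "g \<in> ?V"
      using topT closure_of_subset_topspace [of T ?U] by auto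
    then have "T closure_of ?U \<inter> ?V \<noteq> {}"
      using g(1) by blast
    moreover have "?U \<inter> ?V = {}"
      by auto
    ultimately show False
      using openin_Int_closure_of_eq_empty [OF V, of ?U] by (simp only: Int_commute)
  qed
  show "T = discrete_topology (cfun X) \<longleftrightarrow> I = {?z}"
    using discrete P P_space_discrete_topology by metis
  show "extremally_disconnected_space T \<longleftrightarrow> I = {?z}"
    using discrete E extremally_disconnected_space_discrete_topology by metis
  show "P_space T \<longleftrightarrow> I = {?z}"
    using discrete P P_space_discrete_topology by metis
qed

end

theorem theorem7p9:
  fixes X :: "'a topology" and I :: "('a \<Rightarrow> real) set"
  assumes "tychonoff_space X"
    and "ideal I (cfun_ring X)"
  shows "(C_u X I = discrete_topology (cfun X) \<longleftrightarrow> C_m X I = discrete_topology (cfun X))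
    \<and> (C_m X I = discrete_topology (cfun X) \<longleftrightarrow> extremally_disconnected_space (C_u X I))
    \<and> (extremally_disconnected_space (C_u X I) \<longleftrightarrow> extremally_disconnected_space (C_m X I))
    \<and> (extremally_disconnected_space (C_m X I) \<longleftrightarrow> I = {\<zero>\<^bsub>cfun_ring X\<^esub>})
    \<and> (I = {\<zero>\<^bsub>cfun_ring X\<^esub>} \<longleftrightarrow> P_space (C_m X I))
    \<and> (P_space (C_m X I) \<longleftrightarrow> P_space (C_u X I))"
proof -
  note I = assms(2)
  note between = openin_C_u_imp_C_m [OF I]
  show ?thesis
    \<comment> \<open>Filling the first inclusion with \<open>between\<close> takes \<open>T\<close>
      to be \<open>C_m X I\<close>, filling the second takes it to be \<open>C_u X I\<close>; the
      other inclusion is then trivial. Every statement reduces to \<open>I\<close> being the zero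
      ideal.\<close>
    by (simp only: discrete_iff_zero_ideal [OF I between] discrete_iff_zero_ideal [OF I _ between]
        extremally_disconnected_iff_zero_ideal [OF I between]
        extremally_disconnected_iff_zero_ideal [OF I _ between]
        P_space_iff_zero_ideal [OF I between] P_space_iff_zero_ideal [OF I _ between])
qed

end
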